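(* Let $q$ be a prime power and $n\ge1$. The number $a_n$ of ordered pairs $(f,g)$ of coprime monic polynomials in $\mathbb{F}_q[X]$ of degree $n$, both with nonzero constant term, is $$a_n=q(q-1)^3\frac{q^{2n-2}-1}{q^2-1}+(q-1)(q-2).$$ *)

theory Defs
  imports
    "HOL-Library.Cardinality"
    "HOL-Computational_Algebra.Computational_Algebra"
    "HOL-Number_Theory.Prime_Powers"
begin

definition coprime_monic_pairs :: "nat \<Rightarrow> ('a::{field,finite} poly \<times> 'a poly) set" where
  "coprime_monic_pairs n =
    {(f, g). lead_coeff f = 1 \<and> lead_coeff g = 1 \<and> degree f = n \<and> degree g = n \<and>
             coeff f 0 \<noteq> 0 \<and> coeff g 0 \<noteq> 0 \<and> coprime f g}"

end

theory Submission
  imports Defs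
begin

text \<open>
  Dividing by the monic gcd splits each pair of monic polynomials of degree \<open>n\<close> with nonzero
  constant term, in a unique way, into a gcd of degree \<open>k\<close> and a coprime pair of degree \<open>n - k\<close>.
  With \<open>N\<^sub>0 = 1\<close> and \<open>N\<^sub>k = (q - 1) q\<^bsup>k-1\<^esup>\<close> counting such single polynomials, this gives
  \<open>N\<^sub>n\<^sup>2 = (\<Sum>k\<le>n. N\<^sub>k a\<^bsub>n-k\<^esub>)\<close>. As \<open>N\<^bsub>k+1\<^esub> = q N\<^sub>k\<close> for \<open>k \<ge> 1\<close>, subtracting \<open>q\<close> times one such
  identity from the next leaves \<open>a\<^bsub>n+1\<^esub> - a\<^sub>n = N\<^bsub>n+1\<^esub>\<^sup>2 - q N\<^sub>n\<^sup>2\<close>, which telescopes to a geometric sum.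
\<close>

section \<open>Bezout identities and monic divisors over a field\<close>

lemma poly_bezout:
  fixes f g :: "'a::field poly"
  assumes "f \<noteq> 0"
  obtains d u v where "d = u * f + v * g" "d dvd f" "d dvd g" "d \<noteq> 0"
proof -
  define P where "P = (\<lambda>d. d \<noteq> 0 \<and> (\<exists>u v. d = u * f + v * g))"
  have "P f"
    unfolding P_def using assms by (intro conjI exI[of _ 1] exI[of _ 0]) auto
  \<comment> \<open>The gcd is found as a nonzero combination of \<open>f\<close> and
    \<open>g\<close> of least degree.\<close>
  then obtain d where d: "P d" and least: "\<And>e. P e \<Longrightarrow> degree d \<le> degree e"
    using ex_has_least_nat[of P f degree] by auto
  from d obtain u v where uv: "d = u * f + v * g" and "d \<noteq> 0"
    unfolding P_def by blast
  \<comment> \<open>The remainder of a combination modulo \<open>d\<close> is again a combination,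
    of smaller degree if nonzero; minimality forces it to vanish.\<close>
  have dvd: "d dvd h" if "h = s * f + t * g" for h s t
  proof -
    have "h mod d = h - h div d * d"
      by (simp add: minus_div_mult_eq_mod)
    also have "\<dots> = (s - h div d * u) * f + (t - h div d * v) * g"
      unfolding that uv by (simp add: algebra_simps)
    finally have "\<exists>u v. h mod d = u * f + v * g" by blast
    moreover have "degree (h mod d) < degree d" if "h mod d \<noteq> 0"
      using degree_mod_less[OF \<open>d \<noteq> 0\<close>, of h] that by auto
    ultimately show ?thesis
      using least[of "h mod d"] unfolding P_def by (metis linorder_not_le mod_0_imp_dvd)
  qed
  show thesis
    using that[OF uv dvd[of f 1 0] dvd[of g 0 1] \<open>d \<noteq> 0\<close>] by simp
qed

lemma coprime_poly_bezout:
  fixes f g :: "'a::field poly"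
  assumes "coprime f g" "f \<noteq> 0"
  obtains u v where "u * f + v * g = 1"
proof -
  from poly_bezout[OF assms(2), of g] obtain d u v
    where d: "d = u * f + v * g" "d dvd f" "d dvd g" by blast
  with assms(1) have "d dvd 1"
    by (auto dest: coprime_common_divisor)
  then obtain e where "1 = d * e" ..
  with d(1) have "(e * u) * f + (e * v) * g = 1"
    by (simp add: algebra_simps)
  then show thesis by (rule that)
qed

lemma monic_dvd_antisym:
  fixes p q :: "'a::field poly"
  assumes "p dvd q" "q dvd p" "lead_coeff p = 1" "lead_coeff q = 1"
  shows "p = q"
proof -
  from assms(1) obtain r where r: "q = p * r" ..
  have "p \<noteq> 0" "q \<noteq> 0" using assms(3,4) by auto
  then have "degree p = degree q"
    using assms(1,2) by (simp add: dvd_imp_degree_le order_antisym)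
  with r \<open>p \<noteq> 0\<close> \<open>q \<noteq> 0\<close> have "degree r = 0"
    by (auto simp: degree_mult_eq)
  moreover have "lead_coeff r = 1"
    using assms(3,4) r by (simp add: lead_coeff_mult)
  ultimately show ?thesis
    using r by (auto elim: degree_eq_zeroE)
qed

section \<open>Counting monic polynomials\<close>

definition monic_polys :: "nat \<Rightarrow> 'a::field poly set" where
  "monic_polys n = {f. lead_coeff f = 1 \<and> degree f = n}"

definition monic_polys_nz :: "nat \<Rightarrow> 'a::field poly set" where
  "monic_polys_nz n = {f \<in> monic_polys n. coeff f 0 \<noteq> 0}"

lemma monic_polys_0: "monic_polys 0 = {1}"
  by (auto simp: monic_polys_def elim: degree_eq_zeroE)

lemma inj_on_pCons: "inj_on (\<lambda>(a, f). pCons a f) A"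
  by (auto simp: inj_on_def)

lemma monic_pCons_iff:
  "pCons a f \<in> monic_polys (Suc n) \<longleftrightarrow> f \<in> monic_polys n"
  by (cases "f = 0") (auto simp: monic_polys_def)

lemma monic_polys_Suc:
  "monic_polys (Suc n) = (\<lambda>(a, f). pCons a f) ` (UNIV \<times> monic_polys n)"
  (is "?L = ?R")
proof (intro set_eqI)
  fix f :: "'a poly"
  obtain a g where "f = pCons a g" by (cases f)
  then show "f \<in> ?L \<longleftrightarrow> f \<in> ?R"
    by (auto simp: monic_pCons_iff)
qed

text \<open>The head of \<open>pCons\<close> is the constant term, so the extra condition restricts
  only that choice and leaves the tail an arbitrary monic polynomial.\<close>

lemma monic_polys_nz_Suc:
  "monic_polys_nz (Suc n) = (\<lambda>(a, f). pCons a f) ` ((- {0}) \<times> monic_polys n)"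
  unfolding monic_polys_nz_def monic_polys_Suc by auto

lemma card_monic_polys:
  "card (monic_polys n :: 'a::{field,finite} poly set) = CARD('a) ^ n"
proof (induction n)
  case 0
  then show ?case by (simp add: monic_polys_0)
next
  case (Suc n)
  then show ?case
    by (simp add: monic_polys_Suc card_image[OF inj_on_pCons] card_cartesian_product)
qed

lemma finite_monic_polys_nz: "finite (monic_polys_nz n :: 'a::{field,finite} poly set)"
proof -
  have "finite (monic_polys n :: 'a poly set)"
    by (rule card_ge_0_finite) (simp add: card_monic_polys)
  then show ?thesis
    by (simp add: monic_polys_nz_def)
qed

lemma card_monic_polys_nz_0: "card (monic_polys_nz 0 :: 'a::field poly set) = 1"
proof -
  have "monic_polys_nz 0 = {1 :: 'a poly}"
    by (auto simp: monic_polys_nz_def monic_polys_0)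
  then show ?thesis by simp
qed

lemma card_monic_polys_nz_Suc:
  "card (monic_polys_nz (Suc n) :: 'a::{field,finite} poly set) = (CARD('a) - 1) * CARD('a) ^ n"
  by (simp add: monic_polys_nz_Suc card_image[OF inj_on_pCons] card_cartesian_product
      card_monic_polys Compl_eq_Diff_UNIV card_Diff_singleton)

lemma coprime_monic_pairs_eq:
  "coprime_monic_pairs n =
    {(f, g). f \<in> monic_polys_nz n \<and> g \<in> monic_polys_nz n \<and> coprime f g}"
  by (auto simp: coprime_monic_pairs_def monic_polys_nz_def monic_polys_def)

lemma finite_coprime_monic_pairs:
  "finite (coprime_monic_pairs n :: ('a::{field,finite} poly \<times> 'a poly) set)"
  by (rule finite_subset[of _ "monic_polys_nz n \<times> monic_polys_nz n"])
     (auto simp: coprime_monic_pairs_eq finite_monic_polys_nz)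

lemma card_coprime_monic_pairs_0:
  "card (coprime_monic_pairs 0 :: ('a::{field,finite} poly \<times> 'a poly) set) = 1"
proof -
  have "coprime_monic_pairs 0 = {(1, 1) :: 'a poly \<times> 'a poly}"
    by (auto simp: coprime_monic_pairs_eq monic_polys_nz_def monic_polys_0)
  then show ?thesis by simp
qed

section \<open>Splitting off the monic gcd\<close>

lemma monic_polys_nz_mult:
  assumes "d \<in> monic_polys_nz k" "f \<in> monic_polys_nz m"
  shows "d * f \<in> monic_polys_nz (k + m)"
proof -
  have "d \<noteq> 0" "f \<noteq> 0"
    using assms by (auto simp: monic_polys_nz_def)
  then show ?thesis
    using assms
    by (auto simp: monic_polys_nz_def monic_polys_def coeff_mult_degree_sum degree_mult_eq coeff_mult_0)
qed

lemma monic_polys_nz_factor: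
  assumes "d * f \<in> monic_polys_nz n" "lead_coeff d = 1"
  shows "d \<in> monic_polys_nz (degree d)" "f \<in> monic_polys_nz (n - degree d)" "degree d \<le> n"
proof -
  have "d * f \<noteq> 0"
    using assms(1) by (auto simp: monic_polys_nz_def)
  then have "d \<noteq> 0" "f \<noteq> 0" by auto
  then show "d \<in> monic_polys_nz (degree d)" "f \<in> monic_polys_nz (n - degree d)" "degree d \<le> n"
    using assms
    by (auto simp: monic_polys_nz_def monic_polys_def coeff_mult_degree_sum degree_mult_eq coeff_mult_0)
qed

text \<open>Multiplying a Bezout identity for \<open>f\<close> and \<open>g\<close> by
  \<open>d\<close> writes \<open>d\<close> as a combination of \<open>d * f\<close> and
  \<open>d * g\<close>, both multiples of \<open>d'\<close>. Used in both directions, this makes the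
  gcd in the decomposition unique.\<close>

lemma gcd_cofactors_dvd:
  fixes f g :: "'a::field poly"
  assumes "coprime f g" "f \<noteq> 0" "d * f = d' * f'" "d * g = d' * g'"
  shows "d' dvd d"
proof -
  from coprime_poly_bezout[OF assms(1,2)] obtain u v where "u * f + v * g = 1" .
  then have "d = u * (d * f) + v * (d * g)"
    by (metis distrib_left mult.left_commute mult_1_right)
  also have "\<dots> = d' * (u * f' + v * g')"
    using assms(3,4) by (simp add: algebra_simps)
  finally show ?thesis by simp
qed

text \<open>The component \<open>k\<close> is determined as the degree of \<open>d\<close>; carrying
  it along makes the cardinality of the domain a sum over \<open>k\<close>.\<close>

lemma gcd_decomposition_bij:
  "bij_betw (\<lambda>(k, d, f, g). (d * f, d * g))
     (SIGMA k:{..n}. monic_polys_nz k \<times> coprime_monic_pairs (n - k))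
     (monic_polys_nz n \<times> monic_polys_nz n :: ('a::{field,finite} poly \<times> 'a poly) set)"
  (is "bij_betw ?h ?A ?B")
proof (rule bij_betw_imageI)
  show "inj_on ?h ?A"
  proof (rule inj_onI)
    fix x y
    assume x: "x \<in> ?A" and y: "y \<in> ?A" and eq: "?h x = ?h y"
    obtain k d f g where xs: "x = (k, d, f, g)" by (cases x)
    obtain k' d' f' g' where ys: "y = (k', d', f', g')" by (cases y)
    note defs = coprime_monic_pairs_eq monic_polys_nz_def monic_polys_def
    have nz: "d \<noteq> 0" "f \<noteq> 0" "f' \<noteq> 0" and cop: "coprime f g" "coprime f' g'"
      and monic: "lead_coeff d = 1" "lead_coeff d' = 1"
      and deg: "degree d = k" "degree d' = k'"
      using x y unfolding xs ys by (auto simp: defs)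
    have eqs: "d * f = d' * f'" "d * g = d' * g'"
      using eq by (auto simp: xs ys)
    have "d = d'"
      using gcd_cofactors_dvd[OF cop(1) nz(2) eqs]
        gcd_cofactors_dvd[OF cop(2) nz(3) eqs[symmetric]] monic
      by (intro monic_dvd_antisym)
    with eqs nz(1) deg show "x = y"
      by (simp add: xs ys)
  qed
  show "?h ` ?A = ?B"
  proof (intro equalityI subsetI)
    fix z assume "z \<in> ?h ` ?A"
    then obtain k d f g where z: "z = (d * f, d * g)" and k: "k \<le> n"
      and d: "d \<in> monic_polys_nz k"
      and "f \<in> monic_polys_nz (n - k)" "g \<in> monic_polys_nz (n - k)"
      by (auto simp: coprime_monic_pairs_eq)
    with monic_polys_nz_mult[OF d, of _ "n - k"] show "z \<in> ?B"
      by simp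
  next
    fix z assume "z \<in> ?B"
    then obtain F G where z: "z = (F, G)"
      and FG: "F \<in> monic_polys_nz n" "G \<in> monic_polys_nz n" by blast
    have "F \<noteq> 0" using FG by (auto simp: monic_polys_nz_def)
    then obtain c u v where c: "c = u * F + v * G" "c dvd F" "c dvd G" "c \<noteq> 0"
      by (rule poly_bezout)
    \<comment> \<open>The Bezout divisor \<open>c\<close> need not be monic, so it is rescaled by a
      unit.\<close>
    define d where "d = smult (inverse (lead_coeff c)) c"
    have monic: "lead_coeff d = 1" and "d \<noteq> 0"
      using c(4) by (auto simp: d_def)
    have "d dvd F" "d dvd G"
      using c(2-4) by (simp_all add: d_def smult_dvd_iff)
    then obtain f g where f: "F = d * f" and g: "G = d * g"
      by (auto elim!: dvdE)
    \<comment> \<open>Cancelling \<open>d\<close> from the combination for \<open>c\<close> exhibits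
      a nonzero constant as a combination of \<open>f\<close> and \<open>g\<close>, so every common
      divisor of them is a unit.\<close>
    have "d * smult (lead_coeff c) 1 = c"
      using c(4) by (simp add: d_def)
    also have "c = d * (u * f + v * g)"
      unfolding c(1) f g by (simp add: algebra_simps)
    finally have "u * f + v * g = smult (lead_coeff c) 1"
      using \<open>d \<noteq> 0\<close> by (metis mult_left_cancel)
    then have "h dvd smult (lead_coeff c) 1" if "h dvd f" "h dvd g" for h
      using that by (metis dvd_add dvd_mult)
    then have "h dvd 1" if "h dvd f" "h dvd g" for h
      using that c(4) dvd_smult_cancel leading_coeff_0_iff by blast
    then have "coprime f g" by (rule coprimeI)
    moreover note monic_polys_nz_factor[OF FG(1)[unfolded f] monic]
      monic_polys_nz_factor[OF FG(2)[unfolded g] monic]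
    ultimately have "(degree d, d, f, g) \<in> ?A"
      by (auto simp: coprime_monic_pairs_eq)
    then show "z \<in> ?h ` ?A"
      by (rule rev_image_eqI) (simp add: z f g)
  qed
qed

section \<open>The convolution identity and its recurrence\<close>

lemma card_monic_polys_nz_square:
  "card (monic_polys_nz n :: 'a::{field,finite} poly set) ^ 2 =
    (\<Sum>k\<le>n. card (monic_polys_nz k :: 'a poly set) *
       card (coprime_monic_pairs (n - k) :: ('a poly \<times> 'a poly) set))"
  using bij_betw_same_card[OF gcd_decomposition_bij[of n, where 'a='a]]
  by (simp add: card_SigmaI card_cartesian_product finite_monic_polys_nz
      finite_coprime_monic_pairs power2_eq_square)

lemma card_coprime_monic_pairs_rec:
  fixes n :: nat
  defines "q \<equiv> real CARD('a::{field,finite})"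
  defines "N \<equiv> \<lambda>k. real (card (monic_polys_nz k :: 'a poly set))"
  defines "a \<equiv> \<lambda>k. real (card (coprime_monic_pairs k :: ('a poly \<times> 'a poly) set))"
  shows "a (Suc n) = a n + N (Suc n) ^ 2 - q * N n ^ 2"
proof -
  have conv: "N m ^ 2 = (\<Sum>k\<le>m. N k * a (m - k))" for m
    unfolding N_def a_def
    using arg_cong[OF card_monic_polys_nz_square[of m, where 'a='a], of real] by simp
  have N0: "N 0 = 1"
    by (simp add: N_def card_monic_polys_nz_0)
  have NS: "N (Suc k) = (q - 1) * q ^ k" for k
    by (simp add: N_def q_def card_monic_polys_nz_Suc of_nat_diff)
  \<comment> \<open>The index 0 term of the longer sum is \<open>a (Suc n)\<close>; its other terms,
    shifted by one, pair with those of the shorter sum.\<close>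
  have "N (Suc n) ^ 2 - q * N n ^ 2 =
      a (Suc n) + (\<Sum>k\<le>n. (N (Suc k) - q * N k) * a (n - k))"
    unfolding conv[of "Suc n"] conv[of n] sum.atMost_Suc_shift
    by (simp add: N0 sum_subtractf sum_distrib_left algebra_simps)
  \<comment> \<open>Only \<open>k = 0\<close> survives, where the factor is
    \<open>(q - 1) - q = -1\<close>.\<close>
  also have "(\<Sum>k\<le>n. (N (Suc k) - q * N k) * a (n - k)) = (\<Sum>k\<in>{0::nat}. - a n)"
    by (rule sum.mono_neutral_cong_right) (auto simp: NS N0 gr0_conv_Suc)
  finally show ?thesis by simp
qed

section \<open>Summing the recurrence\<close>

theorem theorem2:
  fixes q n :: nat
  assumes "primepow q"
    and "CARD('a) = q"
    and "n \<ge> 1"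
  shows "real (card (coprime_monic_pairs n :: ('a::{field,finite} poly \<times> 'a poly) set)) =
    real q * (real q - 1) ^ 3 * ((real q ^ (2 * n - 2) - 1) / (real q ^ 2 - 1))
      + (real q - 1) * (real q - 2)"
proof -
  define r where "r = real q"
  define a where "a = (\<lambda>k. real (card (coprime_monic_pairs k :: ('a poly \<times> 'a poly) set)))"
  define N where "N = (\<lambda>k. real (card (monic_polys_nz k :: 'a poly set)))"
  have "q > 1" using primepow_gt_Suc_0[OF assms(1)] by simp
  then have "r > 1" by (simp add: r_def)
  then have nz: "r ^ 2 - 1 \<noteq> 0"
    by (simp add: power2_eq_1_iff)
  have rec: "a (Suc m) = a m + N (Suc m) ^ 2 - r * N m ^ 2" for m
    using card_coprime_monic_pairs_rec[of m, where 'a='a]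
    by (simp add: a_def N_def r_def assms(2))
  have NS: "N (Suc k) = (r - 1) * r ^ k" for k
    using \<open>q > 1\<close> by (simp add: N_def r_def card_monic_polys_nz_Suc of_nat_diff assms(2))
  \<comment> \<open>Writing \<open>n = Suc m\<close> turns the exponent \<open>2 * n - 2\<close>
    into \<open>2 * m\<close>. The induction starts at \<open>a 1\<close>, since
    \<open>N 0 = 1\<close> does not fit the geometric pattern of \<open>NS\<close>.\<close>
  have "a (Suc m) = r * (r - 1) ^ 3 * ((r ^ (2 * m) - 1) / (r ^ 2 - 1)) + (r - 1) * (r - 2)" for m
  proof (induction m)
    case 0
    \<comment> \<open>Here \<open>a 1 = 1 + (r - 1)^2 - r = (r - 1) * (r - 2)\<close>.\<close>
    have "a 0 = 1" "N 0 = 1"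
      by (simp_all add: a_def N_def card_coprime_monic_pairs_0 card_monic_polys_nz_0)
    then show ?case
      by (simp add: rec NS power2_eq_square algebra_simps)
  next
    case (Suc m)
    \<comment> \<open>The increment is \<open>(r - 1)^2 * r^(2 * m) * (r^2 - r)\<close>, which
      supplies the next term of a geometric sum with ratio \<open>r^2\<close>.\<close>
    have "N (Suc (Suc m)) ^ 2 - r * N (Suc m) ^ 2 = r * (r - 1) ^ 3 * r ^ (2 * m)"
      by (simp add: NS power_mult_distrib power_mult power2_eq_square power3_eq_cube algebra_simps)
    moreover have "(r ^ (2 * Suc m) - 1) / (r ^ 2 - 1) = (r ^ (2 * m) - 1) / (r ^ 2 - 1) + r ^ (2 * m)"
      using nz by (simp add: field_simps power_add power2_eq_square)
    ultimately show ?case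
      by (simp add: rec[of "Suc m"] Suc.IH distrib_left)
  qed
  from this[of "n - 1"] assms(3) show ?thesis
    by (simp add: a_def r_def right_diff_distrib')
qed

end
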